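(* Let $G$ be a complete multi-partite graph of order $n$ with at least two partite sets. For any $1\le r\le n$ and any $S_0\in\mathcal{P}_r(G)$, we have $S_0\in\mathcal{P}^*_r(G)$ if and only if $$|E_G(S_0)|=\min_{S\in\mathcal{P}_r(G)}|E_G(S)|.$$
   Context: $\mathcal{P}_r(G)$ is the family of $r$-element subsets of $V(G)$. For $S\subseteq V(G)$, $E_G(S)$ is the set of edges incident with at least one vertex of $S$. $\mathcal{P}^*_r(G)$ is the family of all sets $S$ that can be output by the following greedy procedure (over all tie-breaking choices): start with $S=\emptyset$ and $G_1=G$; for $i=1,\dots,r$, choose a vertex $u$ of minimum degree in $G_i$, add $u$ to $S$, and set $G_{i+1}=G_i-u$. *)

theory Defs
  imports Main "HOL-Library.Disjoint_Sets"
begin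

record 'a graph =
  verts :: "'a set"
  edges :: "'a set set"

definition simple_graph :: "'a graph \<Rightarrow> bool" where
  "simple_graph G \<longleftrightarrow>
     finite (verts G) \<and> (\<forall>e \<in> edges G. e \<subseteq> verts G \<and> card e = 2)"

definition degree :: "'a graph \<Rightarrow> 'a \<Rightarrow> nat" where
  "degree G v = card {e \<in> edges G. v \<in> e}"

definition delete_vertex :: "'a graph \<Rightarrow> 'a \<Rightarrow> 'a graph" where
  "delete_vertex G u = \<lparr>verts = verts G - {u}, edges = {e \<in> edges G. u \<notin> e}\<rparr>"

text \<open>The set of partite sets is \<open>P\<close>; \<^const>\<open>partition_on\<close> forces every partite set to be nonempty.\<close>

definition complete_multipartite :: "'a graph \<Rightarrow> 'a set set \<Rightarrow> bool" where
  "complete_multipartite G P \<longleftrightarrow>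
     simple_graph G \<and> partition_on (verts G) P \<and>
     edges G = {{u, v} | u v. \<exists>A \<in> P. \<exists>B \<in> P. A \<noteq> B \<and> u \<in> A \<and> v \<in> B}"

definition r_subsets :: "nat \<Rightarrow> 'a graph \<Rightarrow> 'a set set" where
  "r_subsets r G = {S. S \<subseteq> verts G \<and> card S = r}"

definition incident_edges :: "'a graph \<Rightarrow> 'a set \<Rightarrow> 'a set set" where
  "incident_edges G S = {e \<in> edges G. \<exists>v \<in> S. v \<in> e}"

text \<open>\<open>greedy_run G i S H\<close>: after \<open>i\<close> steps from \<open>G\<close>, under some choice of ties,
  the selected set is \<open>S\<close> and the remaining graph is \<open>H\<close>.\<close>

inductive greedy_run :: "'a graph \<Rightarrow> nat \<Rightarrow> 'a set \<Rightarrow> 'a graph \<Rightarrow> bool"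
  for G :: "'a graph" where
  start: "greedy_run G 0 {} G"
| step: "greedy_run G i S H \<Longrightarrow> is_arg_min (degree H) (\<lambda>w. w \<in> verts H) u
           \<Longrightarrow> greedy_run G (Suc i) (insert u S) (delete_vertex H u)"

definition greedy_sets :: "nat \<Rightarrow> 'a graph \<Rightarrow> 'a set set" where
  "greedy_sets r G = {S. \<exists>H. greedy_run G r S H}"

end

theory Submission
  imports Defs
begin

text \<open>
  In \<open>G - S\<close> a vertex of the partite set \<open>A\<close> has degree \<open>|V - S| - |A - S|\<close>, so the greedy
  procedure always removes a vertex from a largest remaining part, and
  \<open>2 |E(S)| = \<Sum> |A - S|\<^sup>2 + const\<close> among sets \<open>S\<close> of a given size. Both being greedy and being a
  minimiser are equivalent to the balancedness condition that a part \<open>A\<close> meeting \<open>S\<close> satisfies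
  \<open>|B - S| \<le> |A - S| + 1\<close> for every part \<open>B\<close>: a minimiser admits no improving exchange of two
  vertices, and conversely the sum of squares is bounded below by a convexity argument.
\<close>

text \<open>Closed form of the graph left after deleting vertices one at a time; it depends only on
  the set removed, not on the order.\<close>

definition delete_vertices :: "'a graph \<Rightarrow> 'a set \<Rightarrow> 'a graph" where
  "delete_vertices G S = \<lparr>verts = verts G - S, edges = {e \<in> edges G. e \<inter> S = {}}\<rparr>"

text \<open>When a greedy run takes its last vertex from \<open>A\<close>, this part is largest and
  still has \<open>card (A - S) + 1\<close> vertices; other parts can only shrink afterwards. Hence
  the slack of one.\<close>

definition balanced :: "'a set set \<Rightarrow> 'a set \<Rightarrow> bool" where
  "balanced P S \<longleftrightarrow>
     (\<forall>A\<in>P. \<forall>B\<in>P. A \<inter> S \<noteq> {} \<longrightarrow> card (B - S) \<le> card (A - S) + 1)"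

definition residual_square_sum :: "'a set set \<Rightarrow> 'a set \<Rightarrow> int" where
  "residual_square_sum P S = (\<Sum>A\<in>P. (int (card (A - S)))\<^sup>2)"

lemma delete_vertices_empty: "delete_vertices G {} = G"
  by (simp add: delete_vertices_def)

lemma delete_vertex_delete_vertices:
  "delete_vertex (delete_vertices G S) u = delete_vertices G (insert u S)"
  by (auto simp: delete_vertex_def delete_vertices_def)

section \<open>Parts and edges of a complete multipartite graph\<close>

lemma multipartite_finite_verts: "complete_multipartite G P \<Longrightarrow> finite (verts G)"
  by (simp add: complete_multipartite_def simple_graph_def)

lemma multipartite_partition: "complete_multipartite G P \<Longrightarrow> partition_on (verts G) P"
  by (simp add: complete_multipartite_def)

lemma multipartite_finite_parts: "complete_multipartite G P \<Longrightarrow> finite P"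
  using finite_elements multipartite_finite_verts multipartite_partition by blast

lemma multipartite_finite_edges:
  assumes "complete_multipartite G P" shows "finite (edges G)"
proof (rule finite_subset)
  show "edges G \<subseteq> Pow (verts G)"
    using assms unfolding complete_multipartite_def simple_graph_def by blast
  show "finite (Pow (verts G))" using multipartite_finite_verts[OF assms] by simp
qed

lemma part_subset: "partition_on V P \<Longrightarrow> A \<in> P \<Longrightarrow> A \<subseteq> V"
  by (auto simp: partition_on_def)

lemma part_unique: "partition_on V P \<Longrightarrow> A \<in> P \<Longrightarrow> B \<in> P \<Longrightarrow> u \<in> A \<Longrightarrow> u \<in> B \<Longrightarrow> A = B"
  by (auto simp: partition_on_def disjoint_def)

lemma part_exists:
  assumes "partition_on V P" "u \<in> V" obtains A where "A \<in> P" "u \<in> A"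
  using assms by (auto simp: partition_on_def)

lemma card_verts_residual:
  assumes "finite V" "partition_on V P"
  shows "card (V - S) = (\<Sum>A\<in>P. card (A - S))"
proof -
  have "V - S = (\<Union>A\<in>P. A - S)" using assms by (auto simp: partition_on_def)
  moreover have "card (\<Union>A\<in>P. A - S) = (\<Sum>A\<in>P. card (A - S))"
  proof (rule card_UN_disjoint)
    show "finite P" using assms finite_elements by blast
    show "\<forall>A\<in>P. finite (A - S)"
      using assms by (meson finite_Diff finite_subset part_subset)
    show "\<forall>A\<in>P. \<forall>B\<in>P. A \<noteq> B \<longrightarrow> (A - S) \<inter> (B - S) = {}"
      using part_unique[OF assms(2)] by blast
  qed
  ultimately show ?thesis by simp
qed

text \<open>Prepares the counting of neighbours: one endpoint is fixed in place of the symmetric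
  comprehension over unordered pairs.\<close>

lemma multipartite_edge_iff:
  assumes G: "complete_multipartite G P" and A: "A \<in> P" "u \<in> A"
  shows "{u, v} \<in> edges G \<longleftrightarrow> v \<in> verts G - A"
proof
  have E: "edges G = {{u, v} | u v. \<exists>A\<in>P. \<exists>B\<in>P. A \<noteq> B \<and> u \<in> A \<and> v \<in> B}"
    using G by (simp add: complete_multipartite_def)
  note part = multipartite_partition[OF G]
  {
    assume "{u, v} \<in> edges G"
    then obtain x y X Y where xy: "{u, v} = {x, y}" "X \<in> P" "Y \<in> P" "X \<noteq> Y" "x \<in> X" "y \<in> Y"
      unfolding E by blast
    then have "(u = x \<and> v = y) \<or> (u = y \<and> v = x)" by (auto simp: doubleton_eq_iff)
    with xy obtain X' Y' where "X' \<in> P" "Y' \<in> P" "X' \<noteq> Y'" "u \<in> X'" "v \<in> Y'" by metis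
    with A show "v \<in> verts G - A"
      using part_unique[OF part] part_subset[OF part] by blast
  }
  assume v: "v \<in> verts G - A"
  then obtain B where "B \<in> P" "v \<in> B" using part_exists[OF part] by blast
  with v A show "{u, v} \<in> edges G" unfolding E by blast
qed

section \<open>Degrees in the residual graph\<close>

lemma degree_delete_vertices:
  assumes G: "complete_multipartite G P" and A: "A \<in> P" "u \<in> A" and u: "u \<notin> S"
  shows "degree (delete_vertices G S) u + card (A - S) = card (verts G - S)"
proof -
  note part = multipartite_partition[OF G]
  note fin = multipartite_finite_verts[OF G]
  have pair: "\<exists>v. e = {u, v}" if "e \<in> edges G" "u \<in> e" for e
    using G that unfolding complete_multipartite_def simple_graph_def
    by (metis card_2_iff insert_commute insertE singletonD)
  \<comment> \<open>The edges at \<open>u\<close> that survive are indexed injectively by their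
    other endpoints, the surviving vertices outside \<open>A\<close>.\<close>
  have "{e \<in> edges (delete_vertices G S). u \<in> e} = (\<lambda>v. {u, v}) ` ((verts G - S) - (A - S))"
    (is "?L = ?R")
  proof
    show "?L \<subseteq> ?R"
    proof
      fix e assume "e \<in> ?L"
      then have e: "e \<in> edges G" "e \<inter> S = {}" "u \<in> e" by (auto simp: delete_vertices_def)
      then obtain v where v: "e = {u, v}" using pair by blast
      then have "v \<in> verts G - A" using e multipartite_edge_iff[OF G A] by blast
      then show "e \<in> ?R" using v e by blast
    qed
    show "?R \<subseteq> ?L"
      using multipartite_edge_iff[OF G A] u by (auto simp: delete_vertices_def)
  qed
  moreover have "inj_on (\<lambda>v. {u, v}) X" for X by (auto simp: inj_on_def doubleton_eq_iff)
  ultimately have "degree (delete_vertices G S) u = card ((verts G - S) - (A - S))"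
    by (simp add: degree_def card_image)
  also have "\<dots> = card (verts G - S) - card (A - S)"
    using part_subset[OF part A(1)] fin
    by (intro card_Diff_subset) (auto intro: finite_subset)
  finally show ?thesis
    using card_mono[of "verts G - S" "A - S"] part_subset[OF part A(1)] fin by fastforce
qed

text \<open>Degree and residual part size add up to \<open>card (verts G - S)\<close> for every
  remaining vertex, so minimising one maximises the other.\<close>

lemma arg_min_degree_iff:
  assumes G: "complete_multipartite G P" and A: "A \<in> P" "u \<in> A" and u: "u \<notin> S"
  shows "is_arg_min (degree (delete_vertices G S)) (\<lambda>w. w \<in> verts (delete_vertices G S)) u
    \<longleftrightarrow> (\<forall>B\<in>P. card (B - S) \<le> card (A - S))" (is "?L \<longleftrightarrow> ?R")
proof -
  note part = multipartite_partition[OF G]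
  have "u \<in> verts G" using A part_subset[OF part] by blast
  then have L: "?L \<longleftrightarrow> (\<forall>w \<in> verts G - S. degree (delete_vertices G S) u \<le> degree (delete_vertices G S) w)"
    using u by (auto simp: is_arg_min_linorder delete_vertices_def)
  note d = degree_delete_vertices[OF G]
  show ?thesis
  proof
    assume ?L
    show ?R
    proof
      fix B assume B: "B \<in> P"
      show "card (B - S) \<le> card (A - S)"
      proof (cases "B - S = {}")
        \<comment> \<open>A nonempty residual part supplies a competitor \<open>w\<close> for
          \<open>u\<close>; an exhausted part has size 0.\<close>
        case False
        then obtain w where w: "w \<in> B" "w \<notin> S" by blast
        then have "w \<in> verts G - S" using part_subset[OF part B] by blast
        then have "degree (delete_vertices G S) u \<le> degree (delete_vertices G S) w"
          using \<open>?L\<close> L by blast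
        then show ?thesis using d[OF A u] d[OF B w] by linarith
      next
        case True
        then show ?thesis by (metis card.empty le0)
      qed
    qed
  next
    assume R: ?R
    show ?L unfolding L
    proof
      fix w assume w: "w \<in> verts G - S"
      then obtain B where B: "B \<in> P" "w \<in> B" using part_exists[OF part] by blast
      then show "degree (delete_vertices G S) u \<le> degree (delete_vertices G S) w"
        using R d[OF A u] d[OF B] w by fastforce
    qed
  qed
qed

section \<open>Incident edges and residual part sizes\<close>

lemma card_Diff_insert:
  assumes "finite A" "u \<in> A" "u \<notin> S"
  shows "card (A - S) = card (A - insert u S) + 1"
proof -
  have "A - S = insert u (A - insert u S)" using assms by blast
  then show ?thesis using assms by (metis Diff_iff Suc_eq_plus1 card_insert_disjoint finite_Diff insertI1)
qed

text \<open>Parts are disjoint, so only the summand of the part containing \<open>u\<close>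
  changes.\<close>

lemma sum_parts_insert:
  fixes f :: "nat \<Rightarrow> int"
  assumes V: "finite V" "partition_on V P" and A: "A \<in> P" "u \<in> A"
  shows "(\<Sum>B\<in>P. f (card (B - insert u S)))
    = (\<Sum>B\<in>P. f (card (B - S))) - f (card (A - S)) + f (card (A - insert u S))"
proof -
  have "finite P" using V finite_elements by blast
  moreover have "B - insert u S = B - S" if "B \<in> P - {A}" for B
    using that A part_unique[OF V(2)] by blast
  ultimately show ?thesis
    using A by (simp add: sum.remove[of P A])
qed

lemma residual_square_sum_insert:
  assumes V: "finite V" "partition_on V P" and A: "A \<in> P" "u \<in> A" and u: "u \<notin> S"
  shows "residual_square_sum P (insert u S)
    = residual_square_sum P S - 2 * int (card (A - S)) + 1"
proof -
  have "finite A" using V A by (meson finite_subset part_subset)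
  from card_Diff_insert[OF this A(2) u] show ?thesis
    unfolding residual_square_sum_def
    by (subst sum_parts_insert[OF V A, of "\<lambda>k. (int k)\<^sup>2"]) (simp add: power2_eq_square algebra_simps)
qed

text \<open>Let \<open>S\<close> grow by one vertex \<open>u\<close> of \<open>A\<close>, with N =
  \<open>card (verts G - S)\<close> and k = \<open>card (A - S)\<close> before. The new edges number
  N - k, and 2(N - k) is the drop 2N - 1 of the square of N minus the drop 2k - 1 of the square of
  k. The case of empty \<open>S\<close> fixes the constant.\<close>

lemma card_incident_edges:
  assumes G: "complete_multipartite G P" and S: "S \<subseteq> verts G"
  shows "2 * int (card (incident_edges G S)) + (int (card (verts G - S)))\<^sup>2
    = residual_square_sum P S + (int (card (verts G)))\<^sup>2 - residual_square_sum P {}"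
proof -
  note part = multipartite_partition[OF G]
  note fin = multipartite_finite_verts[OF G]
  have "finite S" using S fin finite_subset by blast
  then show ?thesis using S
  proof (induction S rule: finite_induct)
    case empty
    then show ?case by (simp add: incident_edges_def)
  next
    case (insert u S)
    then obtain A where A: "A \<in> P" "u \<in> A" using part_exists[OF part] by blast
    have "incident_edges G (insert u S)
        = incident_edges G S \<union> {e \<in> edges (delete_vertices G S). u \<in> e}"
      by (auto simp: incident_edges_def delete_vertices_def)
    moreover have "incident_edges G S \<inter> {e \<in> edges (delete_vertices G S). u \<in> e} = {}"
      by (auto simp: incident_edges_def delete_vertices_def)
    moreover have "finite (incident_edges G S)" "finite {e \<in> edges (delete_vertices G S). u \<in> e}"
      using multipartite_finite_edges[OF G] by (auto simp: incident_edges_def delete_vertices_def)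
    ultimately have "card (incident_edges G (insert u S))
        = card (incident_edges G S) + degree (delete_vertices G S) u"
      by (simp add: card_Un_disjoint degree_def)
    moreover note degree_delete_vertices[OF G A insert.hyps(2)]
    ultimately have inc: "int (card (incident_edges G (insert u S)))
        = int (card (incident_edges G S)) + int (card (verts G - S)) - int (card (A - S))"
      by linarith
    have "int (card (verts G - S)) = int (card (verts G - insert u S)) + 1"
      using card_Diff_insert[OF fin, of u S] insert by simp
    with inc residual_square_sum_insert[OF fin part A insert.hyps(2)] insert.IH insert.prems
    show ?case by (simp add: power2_eq_square algebra_simps)
  qed
qed

text \<open>All other terms of the counting identity depend only on \<open>G\<close>,
  \<open>P\<close> and \<open>r\<close>.\<close>

lemma card_incident_edges_le_iff:
  assumes G: "complete_multipartite G P" and S: "S \<in> r_subsets r G" and T: "T \<in> r_subsets r G"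
  shows "card (incident_edges G S) \<le> card (incident_edges G T)
    \<longleftrightarrow> residual_square_sum P S \<le> residual_square_sum P T"
proof -
  have "S \<subseteq> verts G" "T \<subseteq> verts G" "card S = card T" using S T by (auto simp: r_subsets_def)
  moreover from this have "card (verts G - S) = card (verts G - T)"
    using multipartite_finite_verts[OF G] by (simp add: card_Diff_subset finite_subset)
  ultimately show ?thesis
    using card_incident_edges[OF G, of S] card_incident_edges[OF G, of T] by simp linarith
qed

section \<open>Greedy sets and balancedness\<close>

lemma greedy_run_properties:
  assumes G: "complete_multipartite G P" and run: "greedy_run G i S H"
  shows "H = delete_vertices G S \<and> balanced P S"
  using run
proof (induction rule: greedy_run.induct)
  case start
  then show ?case by (simp add: delete_vertices_empty balanced_def)
next
  case (step i S H u)
  note part = multipartite_partition[OF G]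
  note fin = multipartite_finite_verts[OF G]
  from step have H: "H = delete_vertices G S" and bal: "balanced P S" by auto
  from step have "u \<in> verts H" by (simp add: is_arg_min_def)
  with H have u: "u \<in> verts G" "u \<notin> S" by (auto simp: delete_vertices_def)
  then obtain A where A: "A \<in> P" "u \<in> A" using part_exists[OF part] by blast
  have max: "\<forall>B\<in>P. card (B - S) \<le> card (A - S)"
    using step.hyps(2) arg_min_degree_iff[OF G A u(2)] by (simp add: H)
  have finB: "finite B" if "B \<in> P" for B
    using that part fin by (meson finite_subset part_subset)
  have "balanced P (insert u S)"
    unfolding balanced_def
  proof (intro ballI impI)
    fix B C assume B: "B \<in> P" and C: "C \<in> P" and meet: "B \<inter> insert u S \<noteq> {}"
    have le: "card (C - insert u S) \<le> card (C - S)" using finB[OF C] by (intro card_mono) auto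
    show "card (C - insert u S) \<le> card (B - insert u S) + 1"
    proof (cases "B = A")
      case True
      \<comment> \<open>\<open>A\<close> was a largest part and loses exactly one vertex, which uses
        up the slack.\<close>
      then show ?thesis using max C le card_Diff_insert[OF finB[OF A(1)] A(2) u(2)] by fastforce
    next
      case False
      then have "u \<notin> B" using part_unique[OF part B A(1)] A by blast
      then have "B - insert u S = B - S" "B \<inter> S \<noteq> {}" using meet by auto
      \<comment> \<open>\<open>B\<close> keeps its residual size while that of \<open>C\<close> can
        only shrink, so the old bound persists.\<close>
      then show ?thesis using bal B C le unfolding balanced_def by (metis le_trans)
    qed
  qed
  then show ?case by (simp add: H delete_vertex_delete_vertices)
qed

lemma balanced_greedy_run:
  assumes G: "complete_multipartite G P"
  shows "S \<subseteq> verts G \<Longrightarrow> card S = r \<Longrightarrow> balanced P S \<Longrightarrow> greedy_run G r S (delete_vertices G S)"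
proof (induction r arbitrary: S)
  case 0
  then have "S = {}" using multipartite_finite_verts[OF G] finite_subset by fastforce
  then show ?case by (simp add: delete_vertices_empty greedy_run.start)
next
  case (Suc r)
  note part = multipartite_partition[OF G]
  note fin = multipartite_finite_verts[OF G]
  have finB: "finite B" if "B \<in> P" for B
    using that part fin by (meson finite_subset part_subset)
  have finS: "finite S" using Suc.prems fin finite_subset by blast
  obtain x where x: "x \<in> S" using Suc.prems by fastforce
  then obtain X where X: "X \<in> P" "x \<in> X" using part_exists[OF part] Suc.prems by blast
  \<comment> \<open>The last vertex to be removed must come from the currently smallest part that meets \<open>S\<close>.\<close>
  obtain A where "A \<in> P" "A \<inter> S \<noteq> {}"
    and min: "\<And>B. B \<in> P \<Longrightarrow> B \<inter> S \<noteq> {} \<Longrightarrow> card (A - S) \<le> card (B - S)"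
    using ex_has_least_nat[of "\<lambda>B. B \<in> P \<and> B \<inter> S \<noteq> {}" X "\<lambda>B. card (B - S)"] x X by blast
  then obtain u where A: "A \<in> P" "u \<in> A" and u: "u \<in> S" by blast
  define S' where "S' = S - {u}"
  have S': "S = insert u S'" "u \<notin> S'" using u by (auto simp: S'_def)
  have cA: "card (A - S') = card (A - S) + 1"
    using card_Diff_insert[OF finB[OF A(1)] A(2) S'(2)] S' by simp
  have other: "B - S' = B - S" "B \<inter> S' = B \<inter> S" if "B \<in> P" "B \<noteq> A" for B
    using that S' part_unique[OF part _ A(1) _ A(2)] by auto
  \<comment> \<open>Putting \<open>u\<close> back turns the slack of one in balancedness at
    \<open>A\<close> into maximality of \<open>A\<close>, so \<open>u\<close> is a legal greedy
    choice after \<open>S'\<close>.\<close>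
  have max: "card (B - S') \<le> card (A - S')" if "B \<in> P" for B
    using that other Suc.prems(3) A cA \<open>A \<inter> S \<noteq> {}\<close> unfolding balanced_def
    by (cases "B = A") auto
  have "balanced P S'" unfolding balanced_def
  proof (intro ballI impI)
    fix B C assume B: "B \<in> P" and C: "C \<in> P" and meet: "B \<inter> S' \<noteq> {}"
    show "card (C - S') \<le> card (B - S') + 1"
    proof (cases "B = A")
      case True
      then show ?thesis using max[OF C] by simp
    next
      case False
      \<comment> \<open>The minimal choice of \<open>A\<close> enters here:
        \<open>card (C - S') \<le> card (A - S) + 1 \<le> card (B - S) + 1\<close>.\<close>
      then show ?thesis using max[OF C] cA min[OF B] other[OF B] meet by fastforce
    qed
  qed
  moreover have "S' \<subseteq> verts G" "card S' = r"
    using Suc.prems u finS by (auto simp: S'_def)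
  ultimately have run: "greedy_run G r S' (delete_vertices G S')" by (intro Suc.IH)
  have "is_arg_min (degree (delete_vertices G S')) (\<lambda>w. w \<in> verts (delete_vertices G S')) u"
    using arg_min_degree_iff[OF G A S'(2)] max by blast
  from greedy_run.step[OF run this] show ?case
    by (simp add: delete_vertex_delete_vertices S')
qed

lemma greedy_sets_iff_balanced:
  assumes "complete_multipartite G P" "S \<in> r_subsets r G"
  shows "S \<in> greedy_sets r G \<longleftrightarrow> balanced P S"
  using assms greedy_run_properties balanced_greedy_run
  unfolding greedy_sets_def r_subsets_def by blast

section \<open>Minimisers and balancedness\<close>

lemma balanced_residual_square_sum_le:
  assumes V: "finite V" "partition_on V P" "S \<subseteq> V" "T \<subseteq> V" "card S = card T"
    and bal: "balanced P S"
  shows "residual_square_sum P S \<le> residual_square_sum P T"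
proof (cases "P = {}")
  case True
  then show ?thesis by (simp add: residual_square_sum_def)
next
  case False
  have finP: "finite P" using V finite_elements by blast
  define m where "m = Max ((\<lambda>A. card (A - S)) ` P)"
  have m_ge: "card (A - S) \<le> m" if "A \<in> P" for A
    using that finP by (simp add: m_def)
  have "m \<in> (\<lambda>A. card (A - S)) ` P" unfolding m_def using finP False by (intro Max_in) auto
  then obtain M where M: "M \<in> P" "m = card (M - S)" by blast
  have "card (V - S) = card (V - T)"
    using V by (simp add: card_Diff_subset finite_subset)
  then have eq: "(\<Sum>A\<in>P. int (card (A - S))) = (\<Sum>A\<in>P. int (card (A - T)))"
    using card_verts_residual[OF V(1,2)] by (metis of_nat_sum)
  \<comment> \<open>The slope \<open>2m - 1\<close> of the square function between \<open>m - 1\<close> and \<open>m\<close> serves as Lagrange multiplier.\<close>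
  have "(2 * int m - 1) * (int (card (A - T)) - int (card (A - S)))
      \<le> (int (card (A - T)))\<^sup>2 - (int (card (A - S)))\<^sup>2" if A: "A \<in> P" for A
  proof -
    define s t where "s = int (card (A - S))" and "t = int (card (A - T))"
    \<comment> \<open>This is the claim with everything moved to one side and \<open>t - s\<close>
      factored out.\<close>
    have "0 \<le> (t - s) * (t + s - 2 * int m + 1)"
    proof (cases "A \<inter> S = {}")
      case True
      have "finite A" using V A by (meson finite_subset part_subset)
      then have "card (A - T) \<le> card (A - S)" using True by (intro card_mono) auto
      then have ts: "t \<le> s" "s \<le> int m" using m_ge[OF A] by (auto simp: s_def t_def)
      \<comment> \<open>If \<open>t < s\<close>, integrality gives
        \<open>t + s \<le> 2 * int m - 1\<close>, so both factors are nonpositive.\<close>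
      show ?thesis
        by (cases "t = s") (use ts in \<open>auto intro!: mult_nonpos_nonpos\<close>)
    next
      case False
      then have "m \<le> card (A - S) + 1" using bal A M unfolding balanced_def by blast
      then have "s = int m \<or> s = int m - 1" using m_ge[OF A] by (auto simp: s_def)
      \<comment> \<open>For either value of \<open>s\<close> the factors are the consecutive
        integers \<open>t - int m\<close> and \<open>t - int m + 1\<close>, whose product is never
        negative.\<close>
      then show ?thesis
        by (auto simp: zero_le_mult_iff)
    qed
    then show ?thesis by (simp add: s_def t_def power2_eq_square algebra_simps)
  qed
  then have "(\<Sum>A\<in>P. (2 * int m - 1) * (int (card (A - T)) - int (card (A - S))))
      \<le> (\<Sum>A\<in>P. (int (card (A - T)))\<^sup>2 - (int (card (A - S)))\<^sup>2)"
    by (rule sum_mono)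
  \<comment> \<open>The linear side sums to 0, since by \<open>eq\<close> the residual sizes for
    \<open>S\<close> and \<open>T\<close> have the same total.\<close>
  then show ?thesis
    using eq by (simp add: residual_square_sum_def sum_subtractf flip: sum_distrib_left)
qed

text \<open>If balancedness fails for \<open>A\<close> and \<open>B\<close>, swapping some
  \<open>a\<close> of \<open>A\<close> in \<open>S\<close> for some \<open>b\<close> of
  \<open>B\<close> outside \<open>S\<close> changes the sum of squares by
  \<open>2 * (card (A - S) + 1 - card (B - S))\<close>, read over the integers, which is
  negative.\<close>

lemma minimal_imp_balanced:
  assumes V: "finite V" "partition_on V P" "S \<subseteq> V"
    and min: "\<And>T. T \<subseteq> V \<Longrightarrow> card T = card S \<Longrightarrow> residual_square_sum P S \<le> residual_square_sum P T"
  shows "balanced P S"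
  unfolding balanced_def
proof (intro ballI impI, rule ccontr)
  fix A B assume A: "A \<in> P" and B: "B \<in> P" and meet: "A \<inter> S \<noteq> {}"
    and big: "\<not> card (B - S) \<le> card (A - S) + 1"
  then obtain a where a: "a \<in> A" "a \<in> S" by blast
  have "B - S \<noteq> {}" using big by (metis card.empty le0)
  then obtain b where b: "b \<in> B" "b \<notin> S" by blast
  have "A \<noteq> B" using big by auto
  then have aB: "a \<notin> B" and bA: "b \<notin> A"
    using part_unique[OF V(2) A B] a b by auto
  \<comment> \<open>Both \<open>S\<close> and the exchanged set arise from \<open>R\<close> by
    inserting one vertex, so the one-vertex formula applies to each.\<close>
  define R where "R = S - {a}"
  have R: "S = insert a R" "a \<notin> R" "b \<notin> R" using a b by (auto simp: R_def)
  have finA: "finite A" and finS: "finite S" using V A by (meson finite_subset part_subset)+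
  have "residual_square_sum P S = residual_square_sum P R - 2 * int (card (A - R)) + 1"
    using residual_square_sum_insert[OF V(1,2) A a(1) R(2)] R(1) by simp
  moreover have "residual_square_sum P (insert b R) = residual_square_sum P R - 2 * int (card (B - R)) + 1"
    using residual_square_sum_insert[OF V(1,2) B b(1) R(3)] by simp
  moreover have "card (A - R) = card (A - S) + 1"
    using card_Diff_insert[OF finA a(1) R(2)] R(1) by simp
  moreover have "B - R = B - S" using aB R by auto
  moreover have "residual_square_sum P S \<le> residual_square_sum P (insert b R)"
  proof (rule min)
    show "insert b R \<subseteq> V" using V(3) R part_subset[OF V(2) B] b by auto
    show "card (insert b R) = card S" using R finS by simp
  qed
  ultimately show False using big by simp
qed

theorem theorem5p2:
  fixes G :: "'a graph" and P :: "'a set set" and S\<^sub>0 :: "'a set" and n r :: nat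
  assumes "complete_multipartite G P"
    and "card (verts G) = n"
    and "2 \<le> card P"
    and "1 \<le> r" and "r \<le> n"
    and "S\<^sub>0 \<in> r_subsets r G"
  shows "S\<^sub>0 \<in> greedy_sets r G \<longleftrightarrow>
    card (incident_edges G S\<^sub>0) = Min ((\<lambda>S. card (incident_edges G S)) ` r_subsets r G)"
proof -
  note G = assms(1) and S\<^sub>0 = assms(6)
  note part = multipartite_partition[OF G]
  note fin = multipartite_finite_verts[OF G]
  have "r_subsets r G \<subseteq> Pow (verts G)" by (auto simp: r_subsets_def)
  then have "finite (r_subsets r G)" using fin by (meson finite_Pow_iff finite_subset)
  then have "card (incident_edges G S\<^sub>0) = Min ((\<lambda>S. card (incident_edges G S)) ` r_subsets r G)
      \<longleftrightarrow> (\<forall>T \<in> r_subsets r G. card (incident_edges G S\<^sub>0) \<le> card (incident_edges G T))"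
    using S\<^sub>0 by (subst eq_Min_iff) auto
  also have "\<dots> \<longleftrightarrow> (\<forall>T \<in> r_subsets r G. residual_square_sum P S\<^sub>0 \<le> residual_square_sum P T)"
    using card_incident_edges_le_iff[OF G S\<^sub>0] by blast
  \<comment> \<open>The convexity bound shows that balanced sets are minimisers; the exchange
    argument gives the converse.\<close>
  also have "\<dots> \<longleftrightarrow> balanced P S\<^sub>0"
    using balanced_residual_square_sum_le[OF fin part, of S\<^sub>0]
      minimal_imp_balanced[OF fin part, of S\<^sub>0] S\<^sub>0
    by (auto simp: r_subsets_def)
  finally show ?thesis using greedy_sets_iff_balanced[OF G S\<^sub>0] by simp
qed

end
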